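(* Let $S$ be a nonempty finite set of graphs on $\Pi$ and $A$ the closed-above model generated by $S$. Then the uninterpreted complex of $A$ is $(n-2)$-connected.
   Context: $\Pi=\{p_1,\dots,p_n\}$. A graph is a directed graph on vertex set $\Pi$ containing all self-loops; $In_G(p)=\{q:(q,p)\in E(G)\}$. $\uparrow G=\{H: E(H)\supseteq E(G)\}$; the closed-above model generated by $S$ is the oblivious model whose set of allowed round graphs is $\bigcup_{G\in S}\uparrow G$. A (colored) simplex is a set $\sigma$ of pairs $(p,v)$ with $p\in\Pi$ such that each $p$ appears in at most one pair; a complex is a set of simplexes closed under taking subsets. The uninterpreted simplex of a graph $H$ is $\sigma_H=\{(p,In_H(p)):p\in\Pi\}$; the uninterpreted complex of an oblivious model with allowed graph set $\mathcal{S}$ is the complex whose facets are exactly the $\sigma_H$, $H\in\mathcal{S}$. A complex is $k$-connected if it is nonempty for $k\ge -1$ and every continuous map from the $m$-sphere into its geometric realization extends to the $(m+1)$-disk for all $0\le m\le k$; every complex is $k$-connected for $k\le -2$. *)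

theory Defs
  imports "HOL-Analysis.Analysis"
begin

text \<open>Processes form a finite type 'p; n = CARD('p).
 A graph is its edge relation on 'p, required to contain all self-loops.\<close>

definition is_graph :: "('p \<times> 'p) set \<Rightarrow> bool" where
  "is_graph E \<longleftrightarrow> (\<forall>p. (p, p) \<in> E)"

definition In_G :: "('p \<times> 'p) set \<Rightarrow> 'p \<Rightarrow> 'p set" where
  "In_G E p = {q. (q, p) \<in> E}"

definition up_closure :: "('p \<times> 'p) set \<Rightarrow> ('p \<times> 'p) set set" where
  "up_closure G = {H. is_graph H \<and> G \<subseteq> H}"

text \<open>Set of allowed round graphs of the closed-above model generated by S.\<close>
definition closed_above_model :: "('p \<times> 'p) set set \<Rightarrow> ('p \<times> 'p) set set" where
  "closed_above_model S = (\<Union>G\<in>S. up_closure G)"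

definition uninterp_simplex :: "('p \<times> 'p) set \<Rightarrow> ('p \<times> 'p set) set" where
  "uninterp_simplex H = {(p, In_G H p) | p. True}"

definition uninterp_complex :: "('p \<times> 'p) set set \<Rightarrow> ('p \<times> 'p set) set set" where
  "uninterp_complex M = {\<tau>. \<exists>H\<in>M. \<tau> \<subseteq> uninterp_simplex H}"

text \<open>Geometric realization of an abstract simplicial complex K on vertex type 'v:
 barycentric-coordinate functions whose support is a simplex of K, with the
 (product = Euclidean, for finite vertex sets) topology.\<close>
definition geom_real_set :: "'v set set \<Rightarrow> ('v \<Rightarrow> real) set" where
  "geom_real_set K = {x. (\<forall>v. 0 \<le> x v) \<and> finite {v. x v \<noteq> 0} \<and> {v. x v \<noteq> 0} \<in> K
                        \<and> sum x {v. x v \<noteq> 0} = 1}"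

definition geom_real :: "'v set set \<Rightarrow> ('v \<Rightarrow> real) topology" where
  "geom_real K = subtopology (powertop_real UNIV) (geom_real_set K)"

text \<open>The closed (m+1)-disk, with boundary nsphere m.\<close>
definition ndisc :: "nat \<Rightarrow> (nat \<Rightarrow> real) topology" where
  "ndisc m = subtopology (Euclidean_space (Suc m)) {x. (\<Sum>i\<le>m. x i ^ 2) \<le> 1}"

definition k_connected :: "int \<Rightarrow> 'v set set \<Rightarrow> bool" where
  "k_connected k K \<longleftrightarrow>
     (k \<ge> -1 \<longrightarrow> topspace (geom_real K) \<noteq> {}) \<and>
     (\<forall>m::nat. int m \<le> k \<longrightarrow>
        (\<forall>f. continuous_map (nsphere m) (geom_real K) f \<longrightarrow>
           (\<exists>g. continuous_map (ndisc m) (geom_real K) g \<and>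
                (\<forall>x\<in>topspace (nsphere m). g x = f x))))"

end

theory Submission
  imports Defs
begin

text \<open>
  Enlarging a graph so that the processes in a set P hear from everybody replaces, in a simplex,
  the vertices coloured by P with the vertices (p, \<Pi>), p \<in> P, and stays within the model. Hence a
  point that carries no mass on some colour can be joined by a segment to the simplex spanned
  by all the vertices (p, \<Pi>). More robustly, if the colour masses of a point are not all equal,
  one first cuts off the masses of the colours below the mean and then moves
  onto the apices (p, \<Pi>) of exactly these colours, so the complement of the
  barycenters of the facets is null-homotopic in the complex. A map from a sphere of dimension
  at most n - 2 has its colour masses in R^n, and a measure-zero argument lets these be
  perturbed off the diagonal. Only the perturbed masses, not the map itself, enter the homotopy.
\<close>

section \<open>Sphere, disk and realization as subspaces of function spaces; extension over the
  disk\<close>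

lemma nsphere_top_of_set:
  "nsphere m = top_of_set {x::nat \<Rightarrow> real. (\<Sum>i\<le>m. x i ^ 2) = 1 \<and> (\<forall>i>m. x i = 0)}"
  by (simp add: nsphere euclidean_product_topology)

lemma ndisc_top_of_set:
  "ndisc m = top_of_set {x::nat \<Rightarrow> real. (\<Sum>i\<le>m. x i ^ 2) \<le> 1 \<and> (\<forall>i>m. x i = 0)}"
proof -
  have "{x::nat \<Rightarrow> real. \<forall>i\<ge>Suc m. x i = 0} \<inter> {x. (\<Sum>i\<le>m. x i ^ 2) \<le> 1} =
      {x. (\<Sum>i\<le>m. x i ^ 2) \<le> 1 \<and> (\<forall>i>m. x i = 0)}"
    by (auto simp: Suc_le_eq)
  then show ?thesis
    by (simp add: ndisc_def Euclidean_space_def subtopology_subtopology euclidean_product_topology)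
qed

lemma geom_real_top_of_set: "geom_real K = top_of_set (geom_real_set K)"
  by (simp add: geom_real_def euclidean_product_topology)

text \<open>Polar coordinates: the homotopy is wrapped around the shell
  \<open>1/2 \<le> r x\<close>, and the inner disk goes to the constant end value \<open>c\<close>,
  so the division by \<open>r x\<close> never matters near the origin.\<close>

lemma nullhomotopic_extends_to_ndisc:
  fixes h :: "real \<times> (nat \<Rightarrow> real) \<Rightarrow> 'b::topological_space"
  assumes cont: "continuous_on ({0..1} \<times> topspace (nsphere m)) h"
    and im: "h \<in> {0..1} \<times> topspace (nsphere m) \<rightarrow> Y"
    and h1: "\<And>x. x \<in> topspace (nsphere m) \<Longrightarrow> h (1, x) = c"
  shows "\<exists>g. continuous_map (ndisc m) (top_of_set Y) g \<and>
             (\<forall>x\<in>topspace (nsphere m). g x = h (0, x))"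
proof -
  let ?S = "topspace (nsphere m)" and ?D = "topspace (ndisc m)"
  have S: "?S = {x. (\<Sum>i\<le>m. x i ^ 2) = 1 \<and> (\<forall>i>m. x i = 0)}"
    by (simp add: nsphere_top_of_set)
  have D: "?D = {x. (\<Sum>i\<le>m. x i ^ 2) \<le> 1 \<and> (\<forall>i>m. x i = 0)}"
    by (simp add: ndisc_top_of_set)
  define r where "r = (\<lambda>x::nat \<Rightarrow> real. sqrt (\<Sum>i\<le>m. x i ^ 2))"
  \<comment> \<open>The time \<open>2 - 2 * r x\<close> runs from 0 on the boundary sphere to 1 on
    the sphere of radius 1/2.\<close>
  define u where "u = (\<lambda>x. (2 - 2 * r x, \<lambda>i. x i / r x))"
  define g where "g = (\<lambda>x. if r x \<le> 1/2 then c else h (u x))"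
  have coord: "continuous_on A (\<lambda>x::nat \<Rightarrow> real. x i)" for A i
    by (rule continuous_on_subset[OF continuous_on_product_coordinates]) simp
  have r: "continuous_on A r" for A
    unfolding r_def by (intro continuous_intros coord)
  \<comment> \<open>Any point of the sphere shows \<open>c\<close> to be a value of \<open>h\<close>
    at time 1, hence in \<open>Y\<close>.\<close>
  have "(\<lambda>n::nat. if n = 0 then 1 else 0 :: real) \<in> ?S"
    by (rule in_topspace_nsphere)
  then have cY: "c \<in> Y"
    using im h1 by (metis PiE SigmaI atLeastAtMost_iff order_refl zero_le_one)
  have u_mem: "u x \<in> {0..1} \<times> ?S" if "x \<in> ?D" "1/2 \<le> r x" for x
  proof -
    have "(\<Sum>i\<le>m. (x i / r x)\<^sup>2) = (\<Sum>i\<le>m. x i ^ 2) / (r x)\<^sup>2"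
      by (simp add: power_divide sum_divide_distrib)
    also have "(\<Sum>i\<le>m. x i ^ 2) = (r x)\<^sup>2"
      by (simp add: r_def sum_nonneg)
    finally have "(\<Sum>i\<le>m. (x i / r x)\<^sup>2) = 1"
      using that by simp
    moreover have "r x \<le> 1"
      using that by (simp add: r_def D)
    ultimately show ?thesis
      using that by (auto simp: u_def S D)
  qed
  have "continuous_on {x \<in> ?D. 1/2 \<le> r x} (\<lambda>x. h (u x))"
  proof (rule continuous_on_compose2[OF cont])
    show "continuous_on {x \<in> ?D. 1/2 \<le> r x} u"
      unfolding u_def
      by (intro continuous_intros continuous_on_coordinatewise_then_product r coord) auto
  qed (use u_mem in blast)
  moreover have "c = h (u x)" if "x \<in> ?D" "r x = 1/2" for x
  proof -
    have "u x \<in> {0..1} \<times> ?S"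
      using that by (intro u_mem) auto
    moreover have "fst (u x) = 1"
      using that by (simp add: u_def)
    ultimately show ?thesis
      by (metis h1 mem_Sigma_iff prod.collapse)
  qed
  ultimately have "continuous_on ?D g"
    unfolding g_def by (intro continuous_on_cases_le r continuous_on_const) auto
  moreover have "g \<in> ?D \<rightarrow> Y"
    using cY im u_mem by (fastforce simp: g_def)
  ultimately have "continuous_map (ndisc m) (top_of_set Y) g"
    by (simp add: ndisc_top_of_set)
  moreover have "g x = h (0, x)" if "x \<in> ?S" for x
    using that by (simp add: g_def u_def r_def S)
  ultimately show ?thesis
    by blast
qed

section \<open>Maps into a geometric realization\<close>

text \<open>Lets a homotopy be written with unnormalised weights: dividing by the positive total
  keeps the support, hence the simplex.\<close>

lemma continuous_into_geom_real:
  fixes K :: "'v::finite set set" and u :: "'x::topological_space \<Rightarrow> 'v \<Rightarrow> real"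
  assumes cont: "\<And>v. continuous_on X (\<lambda>x. u x v)"
    and nonneg: "\<And>x v. x \<in> X \<Longrightarrow> 0 \<le> u x v"
    and nonzero: "\<And>x. x \<in> X \<Longrightarrow> \<exists>v. u x v \<noteq> 0"
    and supp: "\<And>x. x \<in> X \<Longrightarrow> {v. u x v \<noteq> 0} \<in> K"
  defines "g \<equiv> \<lambda>x v. u x v / (\<Sum>w\<in>UNIV. u x w)"
  shows "continuous_on X g \<and> g \<in> X \<rightarrow> geom_real_set K"
proof -
  have pos: "(\<Sum>w\<in>UNIV. u x w) > 0" if x: "x \<in> X" for x
  proof -
    obtain v where "u x v \<noteq> 0"
      using nonzero x by blast
    then have "u x v > 0"
      using nonneg[OF x, of v] by linarith
    then show ?thesis
      using nonneg x by (intro sum_pos2[of _ v]) auto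
  qed
  have "continuous_on X g"
    unfolding g_def using pos
    by (intro continuous_on_coordinatewise_then_product continuous_intros cont) force
  moreover have "g x \<in> geom_real_set K" if x: "x \<in> X" for x
  proof -
    have s: "{v. g x v \<noteq> 0} = {v. u x v \<noteq> 0}"
      using pos[OF x] by (auto simp: g_def)
    have "sum (g x) {v. g x v \<noteq> 0} = sum (g x) UNIV"
      by (rule sum.mono_neutral_left) auto
    also have "\<dots> = 1"
      using pos[OF x] by (simp add: g_def flip: sum_divide_distrib)
    finally show ?thesis
      using s supp[OF x] nonneg[OF x] pos[OF x]
      by (auto simp: geom_real_set_def g_def intro: less_imp_le)
  qed
  ultimately show ?thesis
    by blast
qed

section \<open>Perturbing maps off the diagonal\<close>

text \<open>A dimension count: \<open>S\<close> lies in the unit sphere of a hyperplane, of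
  dimension n - 2, so a smooth image of it swept along the diagonal has measure zero in R^n, and a
  small translation misses the diagonal. Polynomial approximation comes first because a merely
  continuous image may have positive measure.\<close>

lemma approximation_avoiding_diagonal:
  fixes c :: "real^'p::finite \<Rightarrow> real^'p"
  assumes S: "compact S" "S \<subseteq> {z. z $ p0 = 0 \<and> norm z = 1}"
    and c: "continuous_on S c" and "e > 0"
  shows "\<exists>q. continuous_on S q \<and> (\<forall>z\<in>S. norm (c z - q z) < e \<and> (\<exists>i j. q z $ i \<noteq> q z $ j))"
proof -
  \<comment> \<open>Half of \<open>e\<close> is spent on the approximation, half on the translation
    by \<open>w\<close>.\<close>
  obtain g :: "real^'p \<Rightarrow> real^'p" where g: "polynomial_function g"
    and gc: "\<And>z. z \<in> S \<Longrightarrow> norm (c z - g z) < e / 2"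
    using Stone_Weierstrass_polynomial_function[OF S(1) c, of "e / 2"] \<open>e > 0\<close> by auto
  \<comment> \<open>\<open>T\<close> forgets the coordinate \<open>p0\<close> and fixes
    \<open>S\<close>, so \<open>C\<close> is the cylinder over the unit sphere of the
    hyperplane.\<close>
  define T :: "real^'p \<Rightarrow> real^'p" where "T = (\<lambda>z. \<chi> p. if p = p0 then 0 else z $ p)"
  have T: "linear T"
    by (auto simp: T_def linear_iff vec_eq_iff)
  define C where "C = {z. norm (T z) = 1}"
  define Q where "Q = (\<lambda>z. g (T z) + (z $ p0) *\<^sub>R (1 :: real^'p))"
  txt \<open>The coordinate that vanishes on \<open>S\<close> is used to sweep out the diagonal: \<open>Q ` C\<close>
    contains all values of \<open>g\<close> on \<open>S\<close> shifted along \<open>1\<close>.\<close>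
  have "negligible C"
  \<comment> \<open>As \<open>norm (T z)\<close> is homogeneous, each ray from the origin meets
    \<open>C\<close> at most once.\<close>
  proof (rule starlike_negligible[where a = 0])
    have "continuous_on UNIV (\<lambda>z. norm (T z))"
      by (intro continuous_on_norm linear_continuous_on) (simp add: T linear_linear)
    then show "closed C"
      unfolding C_def by (rule closed_Collect_eq[OF _ continuous_on_const])
  qed (simp add: C_def linear_scale[OF T])
  moreover have "Q differentiable_on C"
  proof -
    have "(\<lambda>z. g (T z)) differentiable_on C"
      by (intro differentiable_on_compose[where g = T and f = g] linear_imp_differentiable_on T
          differentiable_on_polynomial_function g)
    moreover have "(\<lambda>z. (z $ p0) *\<^sub>R (1 :: real^'p)) differentiable_on C"
      by (intro linear_imp_differentiable_on) (simp add: linear_iff scaleR_add_left)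
    ultimately show ?thesis
      unfolding Q_def by (rule differentiable_on_add)
  qed
  ultimately have "negligible (Q ` C)"
    by (intro negligible_differentiable_image_negligible) auto
  then have "\<not> ball 0 (e / 2) \<subseteq> Q ` C"
    using \<open>e > 0\<close> open_not_negligible[of "ball (0 :: real^'p) (e / 2)"] negligible_subset by auto
  then obtain w where w: "norm w < e / 2" "w \<notin> Q ` C"
    by (auto simp: subset_eq)
  have "norm (c z - (g z - w)) < e" if "z \<in> S" for z
    using norm_triangle_ineq[of "c z - g z" w] gc[OF that] w(1) by (simp add: algebra_simps)
  moreover have "\<exists>i j. (g z - w) $ i \<noteq> (g z - w) $ j" if z: "z \<in> S" for z
  proof (rule ccontr)
    assume "\<not> ?thesis"
    then have eq: "(g z - w) $ i = (g z - w) $ p0" for i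
      by blast
    \<comment> \<open>If \<open>g z - w\<close> is t times the all-ones vector, then the point of
      \<open>C\<close> over \<open>z\<close> at height -t is sent by \<open>Q\<close> to
      \<open>w\<close>.\<close>
    define z' where "z' = (\<chi> p. if p = p0 then - ((g z - w) $ p0) else z $ p)"
    have Tz': "T z' = z"
      using S(2) z by (auto simp: T_def z'_def vec_eq_iff)
    moreover have "norm z = 1"
      using S(2) z by auto
    ultimately have "z' \<in> C"
      by (simp add: C_def)
    moreover have "Q z' = w"
    proof -
      have "Q z' = g z + (z' $ p0) *\<^sub>R 1"
        by (simp add: Q_def Tz')
      also have "\<dots> = w"
        using eq by (auto simp: vec_eq_iff z'_def algebra_simps)
      finally show ?thesis .
    qed
    ultimately show False
      using w(2) by blast
  qed
  moreover have "continuous_on S (\<lambda>z. g z - w)"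
    by (intro continuous_intros continuous_on_polymonial_function g)
  ultimately show ?thesis
    by (intro exI[of _ "\<lambda>z. g z - w"]) blast
qed


text \<open>Applied to the colour masses of a sphere map. Zeros of \<open>c\<close> must persist in
  \<open>d\<close>, so that a colour above the mean of \<open>d\<close> is one that the map really
  uses; obtaining \<open>d\<close> from \<open>c\<close> by a factor secures this.\<close>

lemma perturbation_avoiding_diagonal:
  fixes c :: "(nat \<Rightarrow> real) \<Rightarrow> 'p::finite \<Rightarrow> real"
  assumes m: "m + 2 \<le> CARD('p)"
    and cont: "\<And>p. continuous_on (topspace (nsphere m)) (\<lambda>y. c y p)"
    and nonneg: "\<And>y p. y \<in> topspace (nsphere m) \<Longrightarrow> 0 \<le> c y p"
    and sum1: "\<And>y. y \<in> topspace (nsphere m) \<Longrightarrow> (\<Sum>p\<in>UNIV. c y p) = 1"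
  shows "\<exists>d :: (nat \<Rightarrow> real) \<Rightarrow> 'p \<Rightarrow> real. (\<forall>p. continuous_on (topspace (nsphere m)) (\<lambda>y. d y p)) \<and>
    (\<forall>y\<in>topspace (nsphere m). (\<forall>p. 0 \<le> d y p) \<and> (\<forall>p. c y p = 0 \<longrightarrow> d y p = 0) \<and>
       (\<exists>i j. d y i \<noteq> d y j))"
proof -
  let ?S = "topspace (nsphere m)"
  have S: "?S = {x. (\<Sum>i\<le>m. x i ^ 2) = 1 \<and> (\<forall>i>m. x i = 0)}"
    by (simp add: nsphere_top_of_set)
  fix p0 :: 'p
  \<comment> \<open>The bound on \<open>m\<close> leaves room for the \<open>m + 1\<close> sphere
    coordinates among the colours other than \<open>p0\<close>.\<close>
  have "card {..m} \<le> card (UNIV - {p0})"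
    using m by simp
  then obtain e where e: "e ` {..m} \<subseteq> UNIV - {p0}" "inj_on e {..m}"
    using card_le_inj[of "{..m}" "UNIV - {p0}"] by auto
  define R where "R = e ` {..m}"
  \<comment> \<open>\<open>Z\<close> carries the sphere into \<open>real^'p\<close>, with zeros
    outside \<open>R\<close>, and \<open>J\<close> reads it back.\<close>
  define Z :: "(nat \<Rightarrow> real) \<Rightarrow> real^'p"
    where "Z = (\<lambda>y. \<chi> p. if p \<in> R then y (inv_into {..m} e p) else 0)"
  define J :: "real^'p \<Rightarrow> nat \<Rightarrow> real"
    where "J = (\<lambda>z i. if i \<le> m then z $ e i else 0)"
  define S' where "S' = sphere 0 1 \<inter> {z :: real^'p. \<forall>p\<in>-R. z $ p = 0}"
  have norm_J: "(\<Sum>i\<le>m. J z i ^ 2) = norm z ^ 2" if "\<forall>p\<in>-R. z $ p = 0" for z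
  proof -
    have "(\<Sum>i\<le>m. J z i ^ 2) = (\<Sum>i\<le>m. (z $ e i)\<^sup>2)"
      by (simp add: J_def)
    also have "\<dots> = (\<Sum>p\<in>R. (z $ p)\<^sup>2)"
      unfolding R_def by (simp add: sum.reindex[OF e(2)])
    also have "\<dots> = (\<Sum>p\<in>UNIV. (z $ p)\<^sup>2)"
      by (rule sum.mono_neutral_left) (use that in auto)
    also have "\<dots> = norm z ^ 2"
      by (simp add: norm_vec_def L2_set_def sum_nonneg)
    finally show ?thesis .
  qed
  have JZ: "J (Z y) = y" if "y \<in> ?S" for y
    using that e(2) by (auto simp: J_def Z_def R_def S fun_eq_iff)
  have Z_S': "Z y \<in> S'" if "y \<in> ?S" for y
  proof -
    have supp: "\<forall>p\<in>-R. Z y $ p = 0"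
      by (simp add: Z_def)
    then have "norm (Z y) ^ 2 = 1"
      using norm_J[OF supp] JZ[OF that] that by (simp add: S)
    then show ?thesis
      using supp by (simp add: S'_def power2_eq_1_iff) (smt (verit) norm_ge_zero)
  qed
  have J_S: "J z \<in> ?S" if "z \<in> S'" for z
    using that norm_J[of z] by (auto simp: S'_def S J_def)
  have "closed {z :: real^'p. \<forall>p\<in>-R. z $ p = 0}"
    by (simp add: Collect_ball_eq closed_INT closed_Collect_eq continuous_on_component)
  then have "compact S'"
    unfolding S'_def by (intro compact_Int_closed compact_sphere)
  moreover have "S' \<subseteq> {z. z $ p0 = 0 \<and> norm z = 1}"
    using e(1) by (auto simp: S'_def R_def)
  moreover have "continuous_on S' (\<lambda>z. \<chi> p. c (J z) p)"
  proof (intro continuous_on_vec_lambda continuous_on_compose2[OF cont])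
    show "continuous_on S' J"
    proof (rule continuous_on_coordinatewise_then_product)
      show "continuous_on S' (\<lambda>z. J z i)" for i
        unfolding J_def by (cases "i \<le> m") (auto intro!: continuous_intros)
    qed
  qed (use J_S in blast)
  \<comment> \<open>The masses sum to 1, so \<open>4 * a\<close> is their mean; accuracy
    \<open>a\<close> then separates masses below \<open>2 * a\<close> from those above the
    mean.\<close>
  moreover define a where "a = 1 / (4 * real CARD('p))"
  moreover have a: "a > 0" "real CARD('p) * (4 * a) = 1"
    by (auto simp: a_def)
  ultimately obtain q where q: "continuous_on S' q"
    "\<And>z. z \<in> S' \<Longrightarrow> norm ((\<chi> p. c (J z) p) - q z) < a"
    "\<And>z. z \<in> S' \<Longrightarrow> \<exists>i j. q z $ i \<noteq> q z $ j"
    using approximation_avoiding_diagonal[of S' p0 "\<lambda>z. \<chi> p. c (J z) p" a] by blast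
  have close: "\<bar>c y p - q (Z y) $ p\<bar> < a" if "y \<in> ?S" for y p
    using component_le_norm_cart[of "(\<chi> p. c (J (Z y)) p) - q (Z y)" p]
      q(2)[OF Z_S'[OF that]] JZ[OF that] by simp
  txt \<open>A multiple of \<open>c\<close> that equals \<open>q\<close> where all masses are at least \<open>2 * a\<close>;
    elsewhere some mass is small while another is at least the mean \<open>4 * a\<close>.\<close>
  define d where "d = (\<lambda>y p. c y p * (max (q (Z y) $ p) a / max (c y p) (2 * a)))"
  show ?thesis
  proof (intro exI[of _ d] conjI allI ballI impI)
    fix p
    have "continuous_on ?S (\<lambda>y. q (Z y))"
    proof (rule continuous_on_compose2[OF q(1)])
      have "continuous_on ?S (\<lambda>y. if p \<in> R then y (inv_into {..m} e p) else 0)" for p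
        by (cases "p \<in> R") (auto intro: continuous_on_subset[OF continuous_on_product_coordinates])
      then show "continuous_on ?S Z"
        unfolding Z_def by (rule continuous_on_vec_lambda)
    qed (use Z_S' in blast)
    then show "continuous_on ?S (\<lambda>y. d y p)"
      unfolding d_def using a(1) by (intro continuous_intros cont) auto
  next
    fix y p
    assume "y \<in> ?S"
    then show "0 \<le> d y p"
      using nonneg a(1) by (auto simp: d_def intro!: mult_nonneg_nonneg divide_nonneg_nonneg)
  next
    fix y p
    assume "c y p = 0"
    then show "d y p = 0"
      by (simp add: d_def)
  next
    fix y
    assume y: "y \<in> ?S"
    \<comment> \<open>Here \<open>q\<close> exceeds \<open>a\<close>, so neither maximum in
      \<open>d\<close> interferes.\<close>
    have d_eq: "d y p = q (Z y) $ p" if "c y p \<ge> 2 * a" for p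
      proof -
      have "max (c y p) (2 * a) = c y p" "max (q (Z y) $ p) a = q (Z y) $ p" "c y p \<noteq> 0"
        using that close[OF y, of p] a(1) by linarith+
      then show ?thesis
        by (simp add: d_def)
    qed
    show "\<exists>i j. d y i \<noteq> d y j"
    proof (cases "\<forall>p. c y p \<ge> 2 * a")
      case True
      then show ?thesis
        using d_eq q(3)[OF Z_S'[OF y]] by metis
    next
      case False
      then obtain p where p: "c y p < 2 * a"
        by (auto simp: not_le)
      have "\<exists>r. c y r \<ge> 4 * a"
      proof (rule ccontr)
        assume "\<not> ?thesis"
        then have "(\<Sum>p\<in>UNIV. c y p) < (\<Sum>p\<in>(UNIV :: 'p set). 4 * a)"
          by (intro sum_strict_mono) (auto simp: not_le)
        then show False
          using sum1[OF y] a(2) by simp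
      qed
      then obtain r where r: "c y r \<ge> 4 * a"
        by blast
      \<comment> \<open>The value \<open>3 * a\<close> separates: at \<open>r\<close>,
        \<open>q\<close> stays above \<open>4 * a - a\<close>; at \<open>p\<close>, \<open>q\<close>
        stays below \<open>2 * a + a\<close> and the factor \<open>c y p / (2 * a)\<close> is at
        most 1.\<close>
      have "d y r > 3 * a"
        using d_eq[of r] close[OF y, of r] r a(1) by linarith
      moreover have "d y p < 3 * a"
      proof -
        have "d y p = (c y p / (2 * a)) * max (q (Z y) $ p) a"
          using p by (simp add: d_def max_def)
        also have "\<dots> \<le> 1 * max (q (Z y) $ p) a"
          using p a(1) by (intro mult_right_mono) auto
        also have "\<dots> < 3 * a"
          using close[OF y, of p] p a(1) by auto
        finally show ?thesis .
      qed
      ultimately show ?thesis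
        by (intro exI[of _ r] exI[of _ p]) simp
    qed
  qed
qed

section \<open>Contracting spheres in a recolourable complex\<close>

lemma exists_above_below_mean:
  fixes d :: "'p::finite \<Rightarrow> real"
  assumes "d i \<noteq> d j"
  shows "\<exists>p. d p > (\<Sum>p\<in>UNIV. d p) / CARD('p)" "\<exists>p. d p < (\<Sum>p\<in>UNIV. d p) / CARD('p)"
proof -
  let ?a = "(\<Sum>p\<in>UNIV. d p) / CARD('p)"
  have 0: "(\<Sum>p\<in>UNIV. d p - ?a) = 0" "(\<Sum>p\<in>UNIV. ?a - d p) = 0"
    by (simp_all add: sum_subtractf)
  show "\<exists>p. d p > ?a"
  proof (rule ccontr)
    assume "\<not> ?thesis"
    then have "\<forall>p\<in>UNIV. ?a - d p = 0"
      using 0(2) by (subst sum_nonneg_eq_0_iff[symmetric]) (auto simp: not_less)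
    then show False
      using assms by (metis UNIV_I right_minus_eq)
  qed
  show "\<exists>p. d p < ?a"
  proof (rule ccontr)
    assume "\<not> ?thesis"
    then have "\<forall>p\<in>UNIV. d p - ?a = 0"
      using 0(1) by (subst sum_nonneg_eq_0_iff[symmetric]) (auto simp: not_less)
    then show False
      using assms by (metis UNIV_I right_minus_eq)
  qed
qed

text \<open>\<open>swap\<close> carries the argument: for \<open>P\<close> all colours it gives the
  simplex of apices where the homotopy ends, and for \<open>P\<close> the colours below the mean it
  gives a simplex joining what survives of the map to the new apices.\<close>

lemma k_connected_if_recolorable:
  fixes K :: "'v::finite set set" and color :: "'v \<Rightarrow> 'p::finite" and apex :: "'p \<Rightarrow> 'v"
  assumes color: "\<And>p. color (apex p) = p"
    and ne: "K \<noteq> {}"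
    and sub: "\<And>\<sigma> \<tau>. \<tau> \<in> K \<Longrightarrow> \<sigma> \<subseteq> \<tau> \<Longrightarrow> \<sigma> \<in> K"
    and swap: "\<And>\<tau> P. \<tau> \<in> K \<Longrightarrow> {v \<in> \<tau>. color v \<notin> P} \<union> apex ` P \<in> K"
  shows "k_connected (int CARD('p) - 2) K"
proof -
  have apexK: "range apex \<in> K"
    using ne swap[of _ UNIV] by auto
  have "(\<lambda>v. if v = apex undefined then 1 else 0) \<in> geom_real_set K"
    using sub[OF apexK, of "{apex undefined}"] by (simp add: geom_real_set_def)
  then have "topspace (geom_real K) \<noteq> {}"
    by (auto simp: geom_real_top_of_set)
  moreover have "\<exists>g. continuous_map (ndisc m) (geom_real K) g \<and> (\<forall>x\<in>topspace (nsphere m). g x = f x)"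
    if m: "int m \<le> int CARD('p) - 2" and f: "continuous_map (nsphere m) (geom_real K) f" for m f
  proof -
    let ?S = "topspace (nsphere m)"
    have f_im: "f y \<in> geom_real_set K" if "y \<in> ?S" for y
      using f that by (auto simp: nsphere_top_of_set geom_real_top_of_set)
    have f_contv: "continuous_on ?S (\<lambda>y. f y v)" for v
      using f by (auto simp: nsphere_top_of_set geom_real_top_of_set intro: continuous_on_product_then_coordinatewise)
    have f_nonneg: "0 \<le> f y v" and f_supp: "{v. f y v \<noteq> 0} \<in> K" if "y \<in> ?S" for y v
      using f_im[OF that] by (auto simp: geom_real_set_def)
    have f_sum: "(\<Sum>v\<in>UNIV. f y v) = 1" if "y \<in> ?S" for y
    proof -
      have "(\<Sum>v\<in>UNIV. f y v) = sum (f y) {v. f y v \<noteq> 0}"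
        by (rule sum.mono_neutral_right) auto
      then show ?thesis
        using f_im[OF that] by (simp add: geom_real_set_def)
    qed
    define c where "c = (\<lambda>y p. \<Sum>v | color v = p. f y v)"
    have c1: "m + 2 \<le> CARD('p)"
      using m by linarith
    have c2: "continuous_on ?S (\<lambda>y. c y p)" for p
      unfolding c_def by (intro continuous_intros f_contv)
    have c3: "0 \<le> c y p" if "y \<in> ?S" for y p
      unfolding c_def by (intro sum_nonneg f_nonneg that)
    have c4: "(\<Sum>p\<in>UNIV. c y p) = 1" if "y \<in> ?S" for y
      using f_sum[OF that] sum.group[of UNIV UNIV color "f y"] by (simp add: c_def)
    obtain d :: "(nat \<Rightarrow> real) \<Rightarrow> 'p \<Rightarrow> real"
      where d: "\<And>p. continuous_on ?S (\<lambda>y. d y p)"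
      "\<And>y p. y \<in> ?S \<Longrightarrow> 0 \<le> d y p"
      "\<And>y p. y \<in> ?S \<Longrightarrow> c y p = 0 \<Longrightarrow> d y p = 0"
      "\<And>y. y \<in> ?S \<Longrightarrow> \<exists>i j. d y i \<noteq> d y j"
      using perturbation_avoiding_diagonal[of m c, OF c1 c2 c3 c4] by metis
    define a where "a = (\<lambda>y. (\<Sum>p\<in>UNIV. d y p) / CARD('p))"
    \<comment> \<open>\<open>hi\<close> scales the surviving part of \<open>f\<close>,
      \<open>lo\<close> the incoming apices. They are never positive at the same colour, and each is
      positive somewhere since \<open>d y\<close> is not constant.\<close>
    define hi where "hi = (\<lambda>y p. max (d y p - a y) 0)"
    define lo where "lo = (\<lambda>y p. max (a y - d y p) 0)"
    have a_nonneg: "0 \<le> a y" if "y \<in> ?S" for y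
      using d(2)[OF that] by (simp add: a_def sum_nonneg)
    have hi_nonneg: "0 \<le> hi y p" and lo_nonneg: "0 \<le> lo y p" for y p
      by (auto simp: hi_def lo_def)
    \<comment> \<open>A colour above the nonnegative mean has \<open>d y p > 0\<close>, hence
      positive mass in \<open>f\<close> itself, so cutting off does not annihilate the
      point.\<close>
    have hi_witness: "\<exists>v. 0 < f y v \<and> 0 < hi y (color v)" if y: "y \<in> ?S" for y
    proof -
      obtain p where p: "d y p > a y"
        using d(4)[OF y] exists_above_below_mean(1)[of "d y"] unfolding a_def by blast
      then have "c y p \<noteq> 0"
        using d(3)[OF y, of p] a_nonneg[OF y] by force
      then obtain v where "color v = p" "f y v \<noteq> 0"
        unfolding c_def by (metis (mono_tags, lifting) mem_Collect_eq sum.neutral)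
      then show ?thesis
        using p f_nonneg[OF y, of v] by (intro exI[of _ v]) (auto simp: hi_def)
    qed
    have lo_witness: "\<exists>p. 0 < lo y p" if y: "y \<in> ?S" for y
    proof -
      obtain p where "d y p < a y"
        using d(4)[OF y] exists_above_below_mean(2)[of "d y"] unfolding a_def by blast
      then show ?thesis
        by (intro exI[of _ p]) (simp add: lo_def)
    qed
    txt \<open>The homotopy has three stages of unit length, in unnormalised coordinates: first \<open>f\<close>
      is cut off to the colours above the mean, then moved to the apices of the colours below
      the mean, and finally contracted in the simplex of all apices.\<close>
    define k1 :: "real \<Rightarrow> real" where "k1 = (\<lambda>s. max 0 (1 - s))"
    define k2 :: "real \<Rightarrow> real" where "k2 = (\<lambda>s. max 0 (min s (2 - s)))"
    define k3 :: "real \<Rightarrow> real" where "k3 = (\<lambda>s. max 0 (min (s - 1) (3 - s)))"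
    define k4 :: "real \<Rightarrow> real" where "k4 = (\<lambda>s. max 0 (s - 2))"
    note k_defs = k1_def k2_def k3_def k4_def
    have k_nonneg: "0 \<le> k1 s" "0 \<le> k2 s" "0 \<le> k3 s" "0 \<le> k4 s" for s
      by (auto simp: k_defs)
    \<comment> \<open>On the stages [0,1], [1,2], [2,3] of \<open>s\<close> the active weights are
      \<open>k1, k2\<close>, then \<open>k2, k3\<close>, then \<open>k3, k4\<close>, in each case
      summing to 1.\<close>
    define u where "u = (\<lambda>x v. let s = 3 * fst x; y = snd x in
        f y v * (k1 s + k2 s * hi y (color v)) +
        of_bool (v = apex (color v)) * (k3 s * lo y (color v) + k4 s))"
    have u: "u (t, y) v = f y v * (k1 (3 * t) + k2 (3 * t) * hi y (color v)) +
        (if v = apex (color v) then k3 (3 * t) * lo y (color v) + k4 (3 * t) else 0)" for t y v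
      by (simp add: u_def Let_def of_bool_def)
    define h where "h = (\<lambda>x v. u x v / (\<Sum>w\<in>UNIV. u x w))"
    have "continuous_on ({0..1} \<times> ?S) h \<and> h \<in> {0..1} \<times> ?S \<rightarrow> geom_real_set K"
      unfolding h_def
    proof (rule continuous_into_geom_real)
      fix v
      have snd: "continuous_on ({0..1::real} \<times> ?S) (\<lambda>x. w (snd x))" if "continuous_on ?S w"
        for w :: "(nat \<Rightarrow> real) \<Rightarrow> real"
        by (rule continuous_on_compose2[OF that continuous_on_snd]) (auto intro: continuous_on_id)
      have a_cont: "continuous_on ?S a"
        unfolding a_def by (intro continuous_intros d(1)) simp
      have hi_cont: "continuous_on ?S (\<lambda>y. hi y p)" and lo_cont: "continuous_on ?S (\<lambda>y. lo y p)" for p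
        unfolding hi_def lo_def by (intro continuous_intros d(1) a_cont)+
      show "continuous_on ({0..1} \<times> ?S) (\<lambda>x. u x v)"
        unfolding u_def Let_def k_defs
        by (intro continuous_intros snd[OF f_contv] snd[OF hi_cont] snd[OF lo_cont])
    next
      fix x :: "real \<times> (nat \<Rightarrow> real)" and v
      assume "x \<in> {0..1} \<times> ?S"
      then obtain t y where x: "x = (t, y)" "y \<in> ?S"
        by auto
      show "0 \<le> u x v"
        using f_nonneg[OF x(2)] k_nonneg hi_nonneg lo_nonneg by (auto simp: x u)
    next
      fix x :: "real \<times> (nat \<Rightarrow> real)"
      assume "x \<in> {0..1} \<times> ?S"
      then obtain t y where x: "x = (t, y)" "y \<in> ?S"
        by auto
      obtain v where v: "0 < f y v" "0 < hi y (color v)"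
        using hi_witness[OF x(2)] by blast
      obtain p where p: "0 < lo y p"
        using lo_witness[OF x(2)] by blast
      define s where "s = 3 * t"
      have "0 \<le> s"
        using \<open>x \<in> _\<close> by (simp add: s_def x)
      \<comment> \<open>On these ranges \<open>k1\<close>, \<open>k2\<close>, \<open>k3\<close>,
        \<open>k4\<close> respectively is strictly positive, joints included.\<close>
      then consider "s < 1" | "1 \<le> s" "s < 2" | "2 \<le> s" "s < 3" | "s \<ge> 3"
        by linarith
      then have "\<exists>v. 0 < u x v"
      proof cases
        case 1
        then have "k1 s > 0"
          by (simp add: k_defs)
        then have "0 < f y v * (k1 s + k2 s * hi y (color v))"
          using v k_nonneg[of s] by (intro mult_pos_pos add_pos_nonneg mult_nonneg_nonneg) auto
        then show ?thesis
          using k_nonneg[of s] lo_nonneg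
          by (intro exI[of _ v]) (auto simp: x u simp flip: s_def intro!: add_pos_nonneg)
      next
        case 2
        then have "k2 s > 0"
          by (simp add: k_defs)
        then have "0 < f y v * (k1 s + k2 s * hi y (color v))"
          using v k_nonneg[of s] by (intro mult_pos_pos add_nonneg_pos) auto
        then show ?thesis
          using k_nonneg[of s] lo_nonneg
          by (intro exI[of _ v]) (auto simp: x u simp flip: s_def intro!: add_pos_nonneg)
      next
        case 3
        then have "k3 s > 0"
          by (simp add: k_defs)
        then have "0 < k3 s * lo y p + k4 s"
          using p k_nonneg[of s] by (intro mult_pos_pos add_pos_nonneg) auto
        then show ?thesis
          using k_nonneg[of s] hi_nonneg f_nonneg[OF x(2)]
          by (intro exI[of _ "apex p"]) (auto simp: x u color simp flip: s_def intro!: add_nonneg_pos)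
      next
        case 4
        then have "k4 s > 0"
          by (simp add: k_defs)
        then have "0 < k3 s * lo y p + k4 s"
          using p k_nonneg[of s] by (intro add_nonneg_pos) auto
        then show ?thesis
          using k_nonneg[of s] hi_nonneg f_nonneg[OF x(2)]
          by (intro exI[of _ "apex p"]) (auto simp: x u color simp flip: s_def intro!: add_nonneg_pos)
      qed
      then show "\<exists>v. u x v \<noteq> 0"
        by (metis less_irrefl)
    next
      fix x :: "real \<times> (nat \<Rightarrow> real)"
      assume "x \<in> {0..1} \<times> ?S"
      then obtain t y where x: "x = (t, y)" "y \<in> ?S"
        by auto
      define s where "s = 3 * t"
      define P where "P = {p. 0 < lo y p}"
      consider "s < 1" | "1 \<le> s" "s \<le> 2" | "s > 2"
        by linarith
      then show "{v. u x v \<noteq> 0} \<in> K"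
      proof cases
        case 1
        then have "k3 s = 0" "k4 s = 0"
          by (auto simp: k_defs)
        then show ?thesis
          by (intro sub[OF f_supp[OF x(2)]]) (auto simp: x u simp flip: s_def)
      next
        case 2
        then have k: "k1 s = 0" "k4 s = 0"
          by (auto simp: k_defs)
        \<comment> \<open>In the middle stage \<open>f\<close> survives only at colours outside
          \<open>P\<close> and apices enter only at colours in \<open>P\<close>, so the support lies
          in the simplex given by \<open>swap\<close>.\<close>
        have "hi y p = 0" if "p \<in> P" for p
          using that by (auto simp: P_def hi_def lo_def)
        moreover have "lo y p = 0" if "p \<notin> P" for p
          using that lo_nonneg[of y p] by (auto simp: P_def)
        ultimately show ?thesis
          using k by (intro sub[OF swap[OF f_supp[OF x(2)], of P]])
            (fastforce simp: x u simp flip: s_def split: if_splits)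
      next
        case 3
        then have "k1 s = 0" "k2 s = 0"
          by (auto simp: k_defs)
        then show ?thesis
          by (intro sub[OF apexK]) (auto simp: x u simp flip: s_def split: if_splits)
      qed
    qed
    \<comment> \<open>At time 1 only \<open>k4\<close> remains: every apex has weight 1, which is
      the barycenter of the apex simplex whatever \<open>y\<close> is.\<close>
    moreover have "h (1, y) = h (1, undefined)" if "y \<in> ?S" for y
      by (simp add: h_def u k_defs cong: if_cong)
    ultimately obtain g where "continuous_map (ndisc m) (top_of_set (geom_real_set K)) g"
      "\<forall>x\<in>?S. g x = h (0, x)"
      using nullhomotopic_extends_to_ndisc[of m h "geom_real_set K" "h (1, undefined)"] by blast
    moreover have "h (0, y) = f y" if "y \<in> ?S" for y
      using f_sum[OF that] by (simp add: h_def u k_defs cong: if_cong)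
    ultimately show ?thesis
      by (auto simp: geom_real_top_of_set)
  qed
  ultimately show ?thesis
    by (simp add: k_connected_def)
qed

section \<open>The closed-above model\<close>

theorem theorem4:
  fixes S :: "('p::finite \<times> 'p) set set"
  assumes "finite S" and "S \<noteq> {}" and "\<forall>G\<in>S. is_graph G"
  shows "k_connected (int CARD('p) - 2) (uninterp_complex (closed_above_model S))"
proof (rule k_connected_if_recolorable[where color = fst and apex = "\<lambda>p. (p, UNIV)"])
  let ?M = "closed_above_model S"
  show "uninterp_complex ?M \<noteq> {}"
    using assms(2,3) by (auto simp: uninterp_complex_def closed_above_model_def up_closure_def)
  fix \<tau> P
  assume "\<tau> \<in> uninterp_complex ?M"
  then obtain H where H: "H \<in> ?M" "\<tau> \<subseteq> uninterp_simplex H"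
    by (auto simp: uninterp_complex_def)
  \<comment> \<open>Adding all edges into \<open>P\<close> gives each process of \<open>P\<close>
    the in-neighbourhood \<open>UNIV\<close> and leaves the other in-neighbourhoods
    unchanged.\<close>
  have "H \<union> UNIV \<times> P \<in> ?M"
    using H(1) by (auto simp: closed_above_model_def up_closure_def is_graph_def)
  moreover have "{v \<in> \<tau>. fst v \<notin> P} \<union> (\<lambda>p. (p, UNIV)) ` P \<subseteq> uninterp_simplex (H \<union> UNIV \<times> P)"
    using H(2) by (fastforce simp: uninterp_simplex_def In_G_def)
  ultimately show "{v \<in> \<tau>. fst v \<notin> P} \<union> (\<lambda>p. (p, UNIV)) ` P \<in> uninterp_complex ?M"
    unfolding uninterp_complex_def by blast
qed (auto simp: uninterp_complex_def)

end
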